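(* Let $\mathsf{P}$ be a Markov transition matrix on a finite state space $\mathcal{X}$ with stationary distribution $\pi$ (with $\pi(x)>0$ for all $x$) and spectral gap at least $\gamma$, and suppose that $\widetilde{\mathsf{P}}$ is an $\varepsilon$-corruption of $\mathsf{P}$. Let $p\in(1,\infty]$ with dual exponent $q$ (i.e. $1/p+1/q=1$). Given the corrupted chain $\widetilde{\mathsf{P}}$ and a restart distribution $\mu$ on $\mathcal{X}$ that is $(\beta,p)$-smooth with respect to $\pi$, PageRank run on $\widetilde{\mathsf{P}}$ with restart distribution $\mu$ and a suitable choice of the parameter $\delta$ outputs a distribution $\widehat{\pi}$ such that $$d_{\mathsf{TV}}(\widehat{\pi},\pi)=\widetilde{O}\left(\sqrt{\frac{\beta\,\varepsilon^{1/q}}{\gamma}}\right).$$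
   Context: A Markov transition matrix on a finite set $\mathcal{X}$ is a matrix $\mathsf{P}\in\mathbb{R}^{\mathcal{X}\times\mathcal{X}}$ with nonnegative entries and rows summing to one. Distributions are row vectors; $\mathbf{1}$ is the all-ones row vector, so $\mathbf{1}^T\mu$ is the matrix all of whose rows equal $\mu$. A distribution $\pi$ is stationary for $\mathsf{P}$ if $\pi\mathsf{P}=\pi$. $\varepsilon$-corruption: given $\mathsf{P}$ with stationary distribution $\pi$, a Markov transition matrix $\widetilde{\mathsf{P}}$ on $\mathcal{X}$ is an $\varepsilon$-corruption of $\mathsf{P}$ if $\sum_{x,y\in\mathcal{X}}\pi(x)\,|\mathsf{P}(x,y)-\widetilde{\mathsf{P}}(x,y)|\le\varepsilon$. PageRank: for a Markov transition matrix $\mathsf{Q}$ on $\mathcal{X}$, a distribution $\mu$ on $\mathcal{X}$ (the restart distribution) and $0\le\delta\le1$, the PageRank chain is $\mathsf{Q}(\delta)=(1-\delta)\mathsf{Q}+\delta\,\mathbf{1}^T\mu$. The output of PageRank run on $\widetilde{\mathsf{P}}$ with restart $\mu$ and parameter $\delta$ is the stationary distribution of $\widetilde{\mathsf{P}}(\delta)=(1-\delta)\widetilde{\mathsf{P}}+\delta\,\mathbf{1}^T\mu$. Norms and smoothness: for $f:\mathcal{X}\to\mathbb{R}$, $\|f\|_{p,\pi}=\left(\sum_x\pi(x)|f(x)|^p\right)^{1/p}$ for $p<\infty$, and $\|f\|_{\infty,\pi}=\max_x|f(x)|$. Here $\mu/\pi$ denotes the pointwise ratio. A distribution $\mu$ is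 $(\beta,p)$-smooth with respect to $\pi$ if $\|\mu/\pi\|_{p,\pi}\le\beta$. Spectral gap: $\gamma(\mathsf{P})=1-\sup\|\mathsf{P}f\|_{2,\pi}/\|f\|_{2,\pi}$, the supremum being over nonzero $f:\mathcal{X}\to\mathbb{R}$ with $\sum_x\pi(x)f(x)=0$, where $(\mathsf{P}f)(x)=\sum_y\mathsf{P}(x,y)f(y)$. Total variation: $d_{\mathsf{TV}}(\nu,\pi)=\frac12\sum_x|\nu(x)-\pi(x)|$. The notation $\widetilde{O}(\cdot)$ means $O(\cdot)$ up to suppressed logarithmic factors. *)

theory Defs
  imports "HOL-Analysis.Analysis"
begin

(* A finite state space is a carrier set X, and distributions, functions and matrices on it are
   functions of which only the values on X matter. A carrier set, rather than a finite type,
   allows constants that are uniform over all finite state spaces. *)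

definition distribution :: "'a set \<Rightarrow> ('a \<Rightarrow> real) \<Rightarrow> bool" where
  "distribution X \<mu> \<longleftrightarrow> (\<forall>x\<in>X. 0 \<le> \<mu> x) \<and> (\<Sum>x\<in>X. \<mu> x) = 1"

definition transition_matrix :: "'a set \<Rightarrow> ('a \<Rightarrow> 'a \<Rightarrow> real) \<Rightarrow> bool" where
  "transition_matrix X P \<longleftrightarrow> (\<forall>x\<in>X. distribution X (P x))"

definition stationary :: "'a set \<Rightarrow> ('a \<Rightarrow> 'a \<Rightarrow> real) \<Rightarrow> ('a \<Rightarrow> real) \<Rightarrow> bool" where
  "stationary X P \<pi> \<longleftrightarrow> distribution X \<pi> \<and> (\<forall>y\<in>X. (\<Sum>x\<in>X. \<pi> x * P x y) = \<pi> y)"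

definition eps_corruption ::
  "'a set \<Rightarrow> ('a \<Rightarrow> 'a \<Rightarrow> real) \<Rightarrow> ('a \<Rightarrow> real) \<Rightarrow> real \<Rightarrow> ('a \<Rightarrow> 'a \<Rightarrow> real) \<Rightarrow> bool" where
  "eps_corruption X P \<pi> \<epsilon> P' \<longleftrightarrow>
     transition_matrix X P' \<and> (\<Sum>x\<in>X. \<Sum>y\<in>X. \<pi> x * \<bar>P x y - P' x y\<bar>) \<le> \<epsilon>"

definition pagerank_chain ::
  "('a \<Rightarrow> 'a \<Rightarrow> real) \<Rightarrow> ('a \<Rightarrow> real) \<Rightarrow> real \<Rightarrow> 'a \<Rightarrow> 'a \<Rightarrow> real" where
  "pagerank_chain Q \<mu> \<delta> x y = (1 - \<delta>) * Q x y + \<delta> * \<mu> y"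

(* "The" stationary distribution: uniqueness is part of being an output. It is automatic for
   \<delta> > 0, but may fail for \<delta> = 0. *)
definition pagerank_output ::
  "'a set \<Rightarrow> ('a \<Rightarrow> 'a \<Rightarrow> real) \<Rightarrow> ('a \<Rightarrow> real) \<Rightarrow> real \<Rightarrow> ('a \<Rightarrow> real) \<Rightarrow> bool" where
  "pagerank_output X Q \<mu> \<delta> \<nu> \<longleftrightarrow>
     stationary X (pagerank_chain Q \<mu> \<delta>) \<nu> \<and>
     (\<forall>\<nu>'. stationary X (pagerank_chain Q \<mu> \<delta>) \<nu>' \<longrightarrow> (\<forall>x\<in>X. \<nu>' x = \<nu> x))"

definition lp_norm :: "'a set \<Rightarrow> ('a \<Rightarrow> real) \<Rightarrow> ereal \<Rightarrow> ('a \<Rightarrow> real) \<Rightarrow> real" where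
  "lp_norm X \<pi> p f =
     (if p = \<infinity> then Max ((\<lambda>x. \<bar>f x\<bar>) ` X)
      else (\<Sum>x\<in>X. \<pi> x * \<bar>f x\<bar> powr real_of_ereal p) powr (1 / real_of_ereal p))"

definition smooth ::
  "'a set \<Rightarrow> ('a \<Rightarrow> real) \<Rightarrow> real \<Rightarrow> ereal \<Rightarrow> ('a \<Rightarrow> real) \<Rightarrow> bool" where
  "smooth X \<pi> \<beta> p \<mu> \<longleftrightarrow> lp_norm X \<pi> p (\<lambda>x. \<mu> x / \<pi> x) \<le> \<beta>"

(* Inserting 0 affects only one-point spaces, where no admissible f exists: it fixes the supremum
   of the empty set of (nonnegative) ratios to be 0. *)
definition spectral_gap :: "'a set \<Rightarrow> ('a \<Rightarrow> 'a \<Rightarrow> real) \<Rightarrow> ('a \<Rightarrow> real) \<Rightarrow> real" where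
  "spectral_gap X P \<pi> =
     1 - Sup (insert 0 {lp_norm X \<pi> 2 (\<lambda>x. \<Sum>y\<in>X. P x y * f y) / lp_norm X \<pi> 2 f | f.
                (\<exists>x\<in>X. f x \<noteq> 0) \<and> (\<Sum>x\<in>X. \<pi> x * f x) = 0})"

definition tv_dist :: "'a set \<Rightarrow> ('a \<Rightarrow> real) \<Rightarrow> ('a \<Rightarrow> real) \<Rightarrow> real" where
  "tv_dist X \<nu> \<pi> = (\<Sum>x\<in>X. \<bar>\<nu> x - \<pi> x\<bar>) / 2"

end

theory Submission
  imports Defs
begin

text \<open>
  PageRank outputs the law of the corrupted walk at an independent geometric time with mean about
  \<open>1 / \<delta>\<close>, started from \<open>\<mu>\<close>. Two errors compete. A long walk accumulates corruption; a short walk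
  has not mixed.

  Everything known about \<open>\<mu>\<close> is condensed into one consequence of Hoelder's inequality
  (\<open>smooth_expectation_le\<close>): a function with values in the unit interval and \<open>\<pi>\<close>-mean at most \<open>\<epsilon>\<close>
  has \<open>\<mu>\<close>-mean at most \<open>E = \<beta> * \<epsilon> powr (1 / q)\<close>. It has two main uses. Applied to the row
  errors of the corruption, averaged along the walk, it shows that each step adds at
  most \<open>2 * E\<close> to the \<open>L\<^sup>1\<close> distance between the corrupted and the original walk
  (\<open>push_corruption_drift\<close>). Applied to the indicator of the set where \<open>\<mu> / \<pi>\<close> exceeds \<open>1 / \<epsilon>\<close>, it
  allows one to replace \<open>\<mu>\<close>, at cost \<open>2 * E\<close>, by a measure of density at most \<open>1 / \<epsilon>\<close>, for which the
  spectral gap gives an \<open>L\<^sup>1\<close> distance to stationarity of order \<open>(1 - \<gamma>) ^ k / sqrt \<epsilon>\<close>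
  (\<open>push_mixing\<close>). So the original walk is close to stationarity after about
  \<open>T = ln (1 / \<epsilon>) / \<gamma>\<close> steps.

  Averaging over the geometric time gives a total variation error of about \<open>E / \<delta> + \<delta> * T\<close>, and
  \<open>\<delta> = sqrt (\<gamma> * E)\<close> makes this \<open>sqrt (E / \<gamma>)\<close> up to the factor \<open>ln (1 / \<epsilon>)\<close>. If \<open>E \<ge> \<gamma>\<close> the bound is
  trivial. If \<open>\<epsilon> = 0\<close> there is no restart, and the spectral gap makes \<open>\<pi>\<close> the only stationary
  distribution.
\<close>

section \<open>Transition matrices acting on measures and on functions\<close>

definition push :: "'a set \<Rightarrow> ('a \<Rightarrow> 'a \<Rightarrow> real) \<Rightarrow> ('a \<Rightarrow> real) \<Rightarrow> 'a \<Rightarrow> real" where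
  "push X Q \<nu> y = (\<Sum>x\<in>X. \<nu> x * Q x y)"

definition pull :: "'a set \<Rightarrow> ('a \<Rightarrow> 'a \<Rightarrow> real) \<Rightarrow> ('a \<Rightarrow> real) \<Rightarrow> 'a \<Rightarrow> real" where
  "pull X Q f x = (\<Sum>y\<in>X. Q x y * f y)"

lemma transition_matrix_nonneg:
  "transition_matrix X Q \<Longrightarrow> x \<in> X \<Longrightarrow> y \<in> X \<Longrightarrow> 0 \<le> Q x y"
  by (simp add: transition_matrix_def distribution_def)

lemma transition_matrix_sum:
  "transition_matrix X Q \<Longrightarrow> x \<in> X \<Longrightarrow> (\<Sum>y\<in>X. Q x y) = 1"
  by (simp add: transition_matrix_def distribution_def)

lemma push_cong:
  assumes "\<And>x. x \<in> X \<Longrightarrow> \<nu> x = \<nu>' x"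
  shows "push X Q \<nu> y = push X Q \<nu>' y"
  unfolding push_def using assms by (intro sum.cong) auto

lemma push_diff: "push X Q (\<lambda>x. \<nu> x - \<nu>' x) y = push X Q \<nu> y - push X Q \<nu>' y"
  by (simp add: push_def left_diff_distrib sum_subtractf)

lemma sum_push_mult: "(\<Sum>y\<in>X. push X Q \<nu> y * f y) = (\<Sum>x\<in>X. \<nu> x * pull X Q f x)"
proof -
  have "(\<Sum>y\<in>X. push X Q \<nu> y * f y) = (\<Sum>y\<in>X. \<Sum>x\<in>X. \<nu> x * Q x y * f y)"
    by (simp add: push_def sum_distrib_right)
  also have "\<dots> = (\<Sum>x\<in>X. \<Sum>y\<in>X. \<nu> x * Q x y * f y)"
    by (rule sum.swap)
  finally show ?thesis by (simp add: pull_def sum_distrib_left mult.assoc)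
qed

text \<open>
  Running the walk from \<open>\<nu>\<close> and testing with \<open>f\<close> is the same as averaging \<open>f\<close> along the walk
  and testing with \<open>\<nu>\<close>. On the function side \<open>\<nu>\<close> stays the restart distribution
  itself, so its smoothness need not be propagated along the walk.
\<close>

lemma sum_push_funpow_mult:
  "(\<Sum>y\<in>X. (push X Q ^^ k) \<nu> y * f y) = (\<Sum>x\<in>X. \<nu> x * (pull X Q ^^ k) f x)"
proof (induction k arbitrary: f)
  case (Suc k)
  have "(\<Sum>y\<in>X. (push X Q ^^ Suc k) \<nu> y * f y) = (\<Sum>x\<in>X. (push X Q ^^ k) \<nu> x * pull X Q f x)"
    by (simp add: sum_push_mult)
  then show ?case by (simp add: Suc.IH funpow_Suc_right del: funpow.simps)
qed simp

lemma sum_push: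
  assumes "transition_matrix X Q"
  shows "(\<Sum>y\<in>X. push X Q \<nu> y) = (\<Sum>x\<in>X. \<nu> x)"
  using sum_push_mult[of X Q \<nu> "\<lambda>_. 1"] assms
  by (simp add: pull_def transition_matrix_sum)

lemma distribution_push:
  assumes "transition_matrix X Q" "distribution X \<nu>"
  shows "distribution X (push X Q \<nu>)"
  using assms sum_push[OF assms(1), of \<nu>]
  by (auto simp: distribution_def push_def transition_matrix_nonneg intro!: sum_nonneg)

lemma distribution_push_funpow:
  assumes "transition_matrix X Q" "distribution X \<nu>"
  shows "distribution X ((push X Q ^^ k) \<nu>)"
  by (induction k) (auto intro: assms distribution_push)

lemma sum_abs_push_le:
  assumes "transition_matrix X Q"
  shows "(\<Sum>y\<in>X. \<bar>push X Q \<nu> y\<bar>) \<le> (\<Sum>x\<in>X. \<bar>\<nu> x\<bar>)"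
proof -
  have "(\<Sum>y\<in>X. \<bar>push X Q \<nu> y\<bar>) \<le> (\<Sum>y\<in>X. push X Q (\<lambda>x. \<bar>\<nu> x\<bar>) y)"
    unfolding push_def
    by (intro sum_mono order.trans[OF sum_abs])
       (simp add: abs_mult transition_matrix_nonneg[OF assms])
  then show ?thesis by (simp add: sum_push[OF assms])
qed

lemma pull_range:
  assumes "transition_matrix X Q" "x \<in> X" "\<And>y. y \<in> X \<Longrightarrow> 0 \<le> f y \<and> f y \<le> 1"
  shows "0 \<le> pull X Q f x \<and> pull X Q f x \<le> 1"
proof -
  have "pull X Q f x \<le> (\<Sum>y\<in>X. Q x y * 1)"
    unfolding pull_def using assms
    by (intro sum_mono mult_left_mono) (auto simp: transition_matrix_nonneg)
  then show ?thesis
    using assms transition_matrix_sum[OF assms(1,2)]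
    by (auto simp: pull_def transition_matrix_nonneg intro!: sum_nonneg)
qed

lemma pull_funpow_range:
  assumes "transition_matrix X Q" "\<And>y. y \<in> X \<Longrightarrow> 0 \<le> f y \<and> f y \<le> 1" "x \<in> X"
  shows "0 \<le> (pull X Q ^^ k) f x \<and> (pull X Q ^^ k) f x \<le> 1"
  using assms(3)
  by (induction k arbitrary: x) (auto intro!: assms(2)
        pull_range[OF assms(1), THEN conjunct1] pull_range[OF assms(1), THEN conjunct2])

lemma stationaryD:
  assumes "stationary X Q \<nu>"
  shows "distribution X \<nu>" "y \<in> X \<Longrightarrow> push X Q \<nu> y = \<nu> y"
  using assms by (auto simp: stationary_def push_def)

lemma push_funpow_stationary:
  assumes "stationary X Q \<nu>" "y \<in> X"
  shows "(push X Q ^^ k) \<nu> y = \<nu> y"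
  using assms(2)
proof (induction k arbitrary: y)
  case (Suc k)
  then show ?case
    using push_cong[of X "(push X Q ^^ k) \<nu>" \<nu>] stationaryD[OF assms(1)] by simp
qed simp

lemma stationary_mean_pull_funpow:
  assumes "stationary X Q \<nu>"
  shows "(\<Sum>x\<in>X. \<nu> x * (pull X Q ^^ k) f x) = (\<Sum>x\<in>X. \<nu> x * f x)"
  using push_funpow_stationary[OF assms]
  by (auto simp flip: sum_push_funpow_mult intro!: sum.cong)

section \<open>Smooth distributions and sets of small stationary mass\<close>

text \<open>
  After dividing \<open>f\<close> and \<open>g\<close> by their norms, this is Young's inequality summed over \<open>X\<close>.
\<close>

lemma Holder_inequality_sum:
  fixes w f g :: "'a \<Rightarrow> real"
  assumes "finite X" "1 < p" "1 < q" "1 / p + 1 / q = 1"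
    and w: "\<And>x. x \<in> X \<Longrightarrow> 0 \<le> w x"
    and f: "\<And>x. x \<in> X \<Longrightarrow> 0 \<le> f x" and g: "\<And>x. x \<in> X \<Longrightarrow> 0 \<le> g x"
  shows "(\<Sum>x\<in>X. w x * (f x * g x))
    \<le> (\<Sum>x\<in>X. w x * f x powr p) powr (1 / p) * (\<Sum>x\<in>X. w x * g x powr q) powr (1 / q)"
proof -
  define F G where "F = (\<Sum>x\<in>X. w x * f x powr p)" and "G = (\<Sum>x\<in>X. w x * g x powr q)"
  have nonneg: "0 \<le> F" "0 \<le> G"
    unfolding F_def G_def by (auto intro!: sum_nonneg mult_nonneg_nonneg w)
  show ?thesis
  proof (cases "F = 0 \<or> G = 0")
    case True
    then have "(\<forall>x\<in>X. w x * f x powr p = 0) \<or> (\<forall>x\<in>X. w x * g x powr q = 0)"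
      unfolding F_def G_def using assms(1) w by (auto simp: sum_nonneg_eq_0_iff)
    then have "(\<Sum>x\<in>X. w x * (f x * g x)) = 0"
      by (intro sum.neutral) auto
    then show ?thesis by (simp add: F_def G_def)
  next
    case False
    then have pos: "0 < F" "0 < G" using nonneg by auto
    define a b where "a = F powr (1 / p)" and "b = G powr (1 / q)"
    have ab: "0 < a" "0 < b" "a powr p = F" "b powr q = G"
      using pos assms(2,3) by (auto simp: a_def b_def powr_powr)
    have "(\<Sum>x\<in>X. w x * (f x / a * (g x / b)))
        \<le> (\<Sum>x\<in>X. w x * ((f x / a) powr p / p + (g x / b) powr q / q))"
      using assms ab by (intro sum_mono mult_left_mono Youngs_inequality) auto
    also have "\<dots> = (\<Sum>x\<in>X. w x * f x powr p / (F * p) + w x * g x powr q / (G * q))"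
      using ab f g by (intro sum.cong) (auto simp: powr_divide field_simps)
    also have "\<dots> = F / (F * p) + G / (G * q)"
      by (simp add: sum.distrib F_def G_def flip: sum_divide_distrib)
    also have "\<dots> = 1" using pos assms(4) by simp
    finally have "(\<Sum>x\<in>X. w x * (f x * g x)) / (a * b) \<le> 1"
      by (simp add: sum_divide_distrib)
    then show ?thesis
      using ab(1,2) by (simp add: field_simps a_def b_def F_def G_def)
  qed
qed

lemma dual_exponent_cases:
  fixes p :: ereal and q :: real
  assumes "1 < p" "1 / p + 1 / ereal q = 1"
  obtains (finite) r where "p = ereal r" "1 < r" "1 < q" "1 / r + 1 / q = 1"
    | (infinite) "p = \<infinity>" "q = 1"
proof -
  have q0: "q \<noteq> 0"
    using assms(2) by (cases p) (auto simp: one_ereal_def zero_ereal_def divide_ereal_def split: if_splits)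
  show ?thesis
  proof (cases p)
    case (real r)
    with assms q0 have r: "1 < r" "1 / r + 1 / q = 1" by (auto simp: one_ereal_def)
    have "0 < 1 / r" "1 / r < 1" using r(1) by auto
    with r(2) have "0 < 1 / q" "1 / q < 1" by linarith+
    then have "1 < q" by (simp add: divide_less_eq split: if_splits)
    with real r finite show ?thesis by blast
  next
    case PInf
    with assms(2) q0 infinite show ?thesis by (auto simp: one_ereal_def)
  qed (use assms(1) in auto)
qed

lemma dual_exponent:
  fixes p :: ereal and q :: real
  assumes "1 < p" "1 / p + 1 / ereal q = 1"
  shows "1 \<le> q" "1 - real_of_ereal (1 / p) = 1 / q"
  using assms by (cases rule: dual_exponent_cases; auto simp: one_ereal_def; fail)+

text \<open>
  With \<open>h = \<mu> / \<pi>\<close>, the left side is the \<open>\<pi>\<close>-mean of \<open>h * g\<close>, which Hoelder's inequality bounds by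
  the \<open>p\<close>-norm of \<open>h\<close> times the \<open>q\<close>-norm of \<open>g\<close>. Since \<open>g\<close> takes values in the unit interval,
  \<open>g powr q \<le> g\<close>, so the \<open>q\<close>-norm is at most \<open>\<epsilon> powr (1 / q)\<close>.
\<close>

lemma smooth_expectation_le:
  fixes p :: ereal and q :: real
  assumes "finite X" and pos: "\<forall>x\<in>X. 0 < \<pi> x" and "1 < p" "1 / p + 1 / ereal q = 1"
    and \<mu>: "distribution X \<mu>" and smooth: "smooth X \<pi> \<beta> p \<mu>"
    and g: "\<And>x. x \<in> X \<Longrightarrow> 0 \<le> g x \<and> g x \<le> 1" and mean: "(\<Sum>x\<in>X. \<pi> x * g x) \<le> \<epsilon>"
  shows "(\<Sum>x\<in>X. \<mu> x * g x) \<le> \<beta> * \<epsilon> powr (1 / q)"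
proof -
  define h where "h x = \<mu> x / \<pi> x" for x
  have h: "0 \<le> h x" "\<mu> x * g x = \<pi> x * (h x * g x)" if "x \<in> X" for x
    using that pos[rule_format, OF that] \<mu> by (auto simp: h_def distribution_def)
  have mean0: "0 \<le> (\<Sum>x\<in>X. \<pi> x * g x)"
    using g pos by (auto intro!: sum_nonneg mult_nonneg_nonneg simp: less_imp_le)
  have norm: "lp_norm X \<pi> p h \<le> \<beta>"
    using smooth by (simp add: smooth_def h_def[abs_def])
  show ?thesis
    using assms(3,4)
  proof (cases rule: dual_exponent_cases)
    case (finite r)
    have "(\<Sum>x\<in>X. \<mu> x * g x) = (\<Sum>x\<in>X. \<pi> x * (h x * g x))"
      by (rule sum.cong[OF refl h(2)])
    also have "\<dots> \<le> (\<Sum>x\<in>X. \<pi> x * h x powr r) powr (1 / r) * (\<Sum>x\<in>X. \<pi> x * g x powr q) powr (1 / q)"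
      using assms(1) finite pos h g by (intro Holder_inequality_sum) (auto simp: less_imp_le)
    also have "(\<Sum>x\<in>X. \<pi> x * h x powr r) powr (1 / r) = lp_norm X \<pi> p h"
      using h by (simp add: lp_norm_def finite)
    also have "lp_norm X \<pi> p h * (\<Sum>x\<in>X. \<pi> x * g x powr q) powr (1 / q) \<le> \<beta> * \<epsilon> powr (1 / q)"
    proof (intro mult_mono norm powr_mono2)
      show "0 \<le> \<beta>"
        using norm finite by (auto simp: lp_norm_def intro: order.trans[OF powr_ge_zero])
      have "g x powr q \<le> g x" if "x \<in> X" for x
        using powr_mono'[of 1 q "g x"] g[OF that] finite by simp
      then show "(\<Sum>x\<in>X. \<pi> x * g x powr q) \<le> \<epsilon>"
        using pos by (intro order.trans[OF sum_mono mean] mult_left_mono) (auto simp: less_imp_le)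
      show "0 \<le> (\<Sum>x\<in>X. \<pi> x * g x powr q)"
        using pos by (auto intro!: sum_nonneg mult_nonneg_nonneg simp: less_imp_le)
    qed (use finite in auto)
    finally show ?thesis .
  next
    case infinite
    have hb: "h x \<le> \<beta>" if "x \<in> X" for x
    proof -
      have "\<bar>h x\<bar> \<le> Max ((\<lambda>x. \<bar>h x\<bar>) ` X)"
        using assms(1) that by (intro Max_ge) auto
      then show ?thesis using norm infinite by (simp add: lp_norm_def)
    qed
    have "X \<noteq> {}" using \<mu> by (auto simp: distribution_def)
    then have \<beta>: "0 \<le> \<beta>" using h(1) hb by (meson equals0I order.trans)
    have "(\<Sum>x\<in>X. \<mu> x * g x) = (\<Sum>x\<in>X. \<pi> x * (h x * g x))"
      by (rule sum.cong[OF refl h(2)])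
    also have "\<dots> \<le> (\<Sum>x\<in>X. \<pi> x * (\<beta> * g x))"
      using pos g hb by (intro sum_mono mult_left_mono mult_right_mono) (auto simp: less_imp_le)
    also have "\<dots> = \<beta> * (\<Sum>x\<in>X. \<pi> x * g x)"
      by (simp add: sum_distrib_left mult.left_commute)
    also have "\<dots> \<le> \<beta> * \<epsilon>" using \<beta> mean by (intro mult_left_mono)
    finally show ?thesis using infinite mean mean0 by simp
  qed
qed

section \<open>Contraction from the spectral gap\<close>

definition l2_norm :: "'a set \<Rightarrow> ('a \<Rightarrow> real) \<Rightarrow> ('a \<Rightarrow> real) \<Rightarrow> real" where
  "l2_norm X \<pi> f = sqrt (\<Sum>x\<in>X. \<pi> x * (f x)\<^sup>2)"

lemma lp_norm_2:
  assumes "\<forall>x\<in>X. 0 \<le> \<pi> x"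
  shows "lp_norm X \<pi> 2 f = l2_norm X \<pi> f"
  using assms
  by (simp add: lp_norm_def l2_norm_def powr_half_sqrt sum_nonneg)

text \<open>
  This is Jensen's inequality followed by stationarity. It makes the set of ratios in the definition
  of the spectral gap bounded, without which its supremum would carry no information.
\<close>

lemma l2_norm_pull_le:
  assumes "transition_matrix X P" and "stationary X P \<pi>"
  shows "l2_norm X \<pi> (pull X P f) \<le> l2_norm X \<pi> f"
proof -
  have "(pull X P f x)\<^sup>2 \<le> pull X P (\<lambda>y. (f y)\<^sup>2) x" if x: "x \<in> X" for x
  proof -
    have "(\<Sum>y\<in>X. sqrt (P x y) * (sqrt (P x y) * f y))\<^sup>2
        \<le> (\<Sum>y\<in>X. (sqrt (P x y))\<^sup>2) * (\<Sum>y\<in>X. (sqrt (P x y) * f y)\<^sup>2)"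
      by (rule Cauchy_Schwarz_ineq_sum)
    then show ?thesis
      using transition_matrix_sum[OF assms(1) x] transition_matrix_nonneg[OF assms(1) x]
      by (simp add: pull_def power_mult_distrib flip: mult.assoc)
  qed
  then have "(\<Sum>x\<in>X. \<pi> x * (pull X P f x)\<^sup>2) \<le> (\<Sum>x\<in>X. \<pi> x * pull X P (\<lambda>y. (f y)\<^sup>2) x)"
    using assms(2) by (intro sum_mono mult_left_mono) (auto simp: stationary_def distribution_def)
  also have "\<dots> = (\<Sum>x\<in>X. \<pi> x * (f x)\<^sup>2)"
    using stationary_mean_pull_funpow[OF assms(2), of 1] by simp
  finally show ?thesis by (simp add: l2_norm_def)
qed

lemma spectral_gap_bounds:
  assumes "finite X" "transition_matrix X P" "stationary X P \<pi>" "\<forall>x\<in>X. 0 < \<pi> x"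
  shows spectral_gap_le_1: "spectral_gap X P \<pi> \<le> 1"
    and l2_norm_pull_gap: "(\<Sum>x\<in>X. \<pi> x * f x) = 0 \<Longrightarrow>
           l2_norm X \<pi> (pull X P f) \<le> (1 - spectral_gap X P \<pi>) * l2_norm X \<pi> f"
proof -
  define A where "A = {l2_norm X \<pi> (pull X P f) / l2_norm X \<pi> f | f.
                (\<exists>x\<in>X. f x \<noteq> 0) \<and> (\<Sum>x\<in>X. \<pi> x * f x) = 0}"
  have norm_pos: "0 < l2_norm X \<pi> f" if "x \<in> X" "f x \<noteq> 0" for f x
    unfolding l2_norm_def using that assms(1,4)
    by (intro iffD2[OF real_sqrt_gt_0_iff] sum_pos2[of X x]) (auto simp: less_imp_le)
  have gap: "spectral_gap X P \<pi> = 1 - Sup (insert 0 A)"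
    using lp_norm_2[of X \<pi>] assms(4) by (simp add: spectral_gap_def A_def pull_def[abs_def] less_imp_le)
  have "a \<le> 1" if "a \<in> insert 0 A" for a
    using that l2_norm_pull_le[OF assms(2,3)] norm_pos
    by (auto simp: A_def divide_le_eq_1)
  then have bdd: "bdd_above (insert 0 A)" by (meson bdd_aboveI)
  have "0 \<le> Sup (insert 0 A)" using bdd by (intro cSup_upper) auto
  then show "spectral_gap X P \<pi> \<le> 1" by (simp add: gap)
  assume mean: "(\<Sum>x\<in>X. \<pi> x * f x) = 0"
  show "l2_norm X \<pi> (pull X P f) \<le> (1 - spectral_gap X P \<pi>) * l2_norm X \<pi> f"
  proof (cases "\<exists>x\<in>X. f x \<noteq> 0")
    case True
    then have "l2_norm X \<pi> (pull X P f) / l2_norm X \<pi> f \<le> Sup (insert 0 A)"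
      using mean by (intro cSup_upper bdd) (auto simp: A_def)
    then show ?thesis using True norm_pos by (auto simp: gap divide_le_eq)
  next
    case False
    then show ?thesis by (simp add: l2_norm_def pull_def)
  qed
qed

lemma l2_norm_pull_funpow:
  assumes "finite X" "transition_matrix X P" "stationary X P \<pi>" "\<forall>x\<in>X. 0 < \<pi> x"
    and "\<gamma> \<le> spectral_gap X P \<pi>" and mean: "(\<Sum>x\<in>X. \<pi> x * f x) = 0"
  shows "l2_norm X \<pi> ((pull X P ^^ k) f) \<le> (1 - \<gamma>) ^ k * l2_norm X \<pi> f"
proof (induction k)
  case (Suc k)
  have nonneg: "0 \<le> l2_norm X \<pi> g" for g
    using assms(4) by (auto simp: l2_norm_def less_imp_le intro!: sum_nonneg)
  have "l2_norm X \<pi> (pull X P ((pull X P ^^ k) f))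
      \<le> (1 - spectral_gap X P \<pi>) * l2_norm X \<pi> ((pull X P ^^ k) f)"
    using assms by (intro l2_norm_pull_gap) (auto simp: stationary_mean_pull_funpow)
  also have "\<dots> \<le> (1 - \<gamma>) * ((1 - \<gamma>) ^ k * l2_norm X \<pi> f)"
    using assms spectral_gap_le_1[OF assms(1-4)] Suc nonneg by (intro mult_mono) auto
  finally show ?case by (simp add: mult.assoc)
qed simp

section \<open>Comparing the corrupted walk with stationarity\<close>

text \<open>
  The property of a smooth \<open>\<mu>\<close> on which the comparison rests. It no longer mentions norms or
  exponents, so the estimates that use it are uniform in \<open>p\<close>.
\<close>

definition small_mean_transfers :: "'a set \<Rightarrow> ('a \<Rightarrow> real) \<Rightarrow> real \<Rightarrow> real \<Rightarrow> ('a \<Rightarrow> real) \<Rightarrow> bool" where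
  "small_mean_transfers X \<pi> \<epsilon> E \<mu> \<longleftrightarrow>
     (\<forall>g. (\<forall>x\<in>X. 0 \<le> g x \<and> g x \<le> 1) \<and> (\<Sum>x\<in>X. \<pi> x * g x) \<le> \<epsilon> \<longrightarrow> (\<Sum>x\<in>X. \<mu> x * g x) \<le> E)"

text \<open>
  The error made by replacing one step of \<open>P\<close> by a step of \<open>P'\<close> at time \<open>k\<close> is at most the mean,
  under the law of the walk at time \<open>k\<close>, of the row error \<open>2 * r\<close>. By duality this is the \<open>\<mu>\<close>-mean
  of the \<open>k\<close>-fold average of \<open>2 * r\<close>. Averaging preserves both the range of \<open>r\<close> and, by stationarity,
  its \<open>\<pi>\<close>-mean, which the definition of a corruption bounds by \<open>\<epsilon> / 2\<close>, so the transfer property applies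
  to the average of \<open>r\<close>.
\<close>

lemma push_corruption_step:
  assumes P: "transition_matrix X P" and st: "stationary X P \<pi>"
    and corr: "eps_corruption X P \<pi> \<epsilon> P'"
    and \<mu>: "distribution X \<mu>" and tr: "small_mean_transfers X \<pi> \<epsilon> E \<mu>"
  shows "(\<Sum>y\<in>X. \<bar>push X P' ((push X P ^^ k) \<mu>) y - push X P ((push X P ^^ k) \<mu>) y\<bar>) \<le> 2 * E"
proof -
  define v where "v = (push X P ^^ k) \<mu>"
  have v: "0 \<le> v x" if "x \<in> X" for x
    using distribution_push_funpow[OF P \<mu>, of k] that by (simp add: v_def distribution_def)
  have P': "transition_matrix X P'" using corr by (simp add: eps_corruption_def)
  \<comment> \<open>Half the row error, so that its values lie in the unit interval.\<close>
  define r where "r x = (\<Sum>y\<in>X. \<bar>P x y - P' x y\<bar>) / 2" for x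
  have r: "0 \<le> r x \<and> r x \<le> 1" if x: "x \<in> X" for x
  proof -
    have "(\<Sum>y\<in>X. \<bar>P x y - P' x y\<bar>) \<le> (\<Sum>y\<in>X. P x y + P' x y)"
      using transition_matrix_nonneg[OF P x] transition_matrix_nonneg[OF P' x]
      by (intro sum_mono) (auto simp: abs_le_iff)
    also have "\<dots> = 2"
      using transition_matrix_sum[OF P x] transition_matrix_sum[OF P' x] by (simp add: sum.distrib)
    finally show ?thesis by (simp add: r_def sum_nonneg)
  qed
  have "(\<Sum>x\<in>X. \<pi> x * r x) = (\<Sum>x\<in>X. \<Sum>y\<in>X. \<pi> x * \<bar>P x y - P' x y\<bar>) / 2"
    by (simp add: r_def sum_divide_distrib sum_distrib_left)
  moreover have "0 \<le> (\<Sum>x\<in>X. \<Sum>y\<in>X. \<pi> x * \<bar>P x y - P' x y\<bar>)"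
    using st by (auto simp: stationary_def distribution_def intro!: sum_nonneg)
  ultimately have "(\<Sum>x\<in>X. \<pi> x * r x) \<le> \<epsilon>"
    using corr by (simp add: eps_corruption_def)
  then have "(\<Sum>x\<in>X. \<pi> x * (pull X P ^^ k) r x) \<le> \<epsilon>"
    by (simp add: stationary_mean_pull_funpow[OF st])
  then have "(\<Sum>x\<in>X. \<mu> x * (pull X P ^^ k) r x) \<le> E"
    using tr pull_funpow_range[OF P, of r] r by (simp add: small_mean_transfers_def)
  then have E: "(\<Sum>x\<in>X. v x * r x) \<le> E"
    by (simp add: v_def sum_push_funpow_mult)
  have "(\<Sum>y\<in>X. \<bar>push X P' v y - push X P v y\<bar>) \<le> (\<Sum>y\<in>X. \<Sum>x\<in>X. v x * \<bar>P x y - P' x y\<bar>)"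
  proof (intro sum_mono)
    fix y assume "y \<in> X"
    have "\<bar>push X P' v y - push X P v y\<bar> = \<bar>\<Sum>x\<in>X. v x * (P' x y - P x y)\<bar>"
      by (simp add: push_def right_diff_distrib sum_subtractf)
    also have "\<dots> \<le> (\<Sum>x\<in>X. \<bar>v x * (P' x y - P x y)\<bar>)" by (rule sum_abs)
    also have "\<dots> = (\<Sum>x\<in>X. v x * \<bar>P x y - P' x y\<bar>)"
      using v by (intro sum.cong) (auto simp: abs_mult abs_minus_commute)
    finally show "\<bar>push X P' v y - push X P v y\<bar> \<le> (\<Sum>x\<in>X. v x * \<bar>P x y - P' x y\<bar>)" .
  qed
  also have "\<dots> = 2 * (\<Sum>x\<in>X. v x * r x)"
    by (subst sum.swap) (simp add: r_def flip: sum_distrib_left sum_divide_distrib)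
  finally show ?thesis using E by (simp add: v_def)
qed

text \<open>
  The step errors add up because later steps of \<open>P'\<close> do not increase the \<open>L\<^sup>1\<close> distance.
\<close>

lemma push_corruption_drift:
  assumes P: "transition_matrix X P" and st: "stationary X P \<pi>"
    and corr: "eps_corruption X P \<pi> \<epsilon> P'"
    and \<mu>: "distribution X \<mu>" and tr: "small_mean_transfers X \<pi> \<epsilon> E \<mu>"
  shows "(\<Sum>y\<in>X. \<bar>(push X P' ^^ k) \<mu> y - (push X P ^^ k) \<mu> y\<bar>) \<le> 2 * E * k"
proof (induction k)
  case (Suc k)
  have P': "transition_matrix X P'" using corr by (simp add: eps_corruption_def)
  let ?u = "(push X P' ^^ k) \<mu>" and ?v = "(push X P ^^ k) \<mu>"
  have "(\<Sum>y\<in>X. \<bar>push X P' ?u y - push X P ?v y\<bar>)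
      \<le> (\<Sum>y\<in>X. \<bar>push X P' (\<lambda>x. ?u x - ?v x) y\<bar> + \<bar>push X P' ?v y - push X P ?v y\<bar>)"
    by (intro sum_mono) (simp add: push_diff)
  also have "\<dots> \<le> (\<Sum>y\<in>X. \<bar>?u y - ?v y\<bar>) + 2 * E"
    unfolding sum.distrib
    by (intro add_mono sum_abs_push_le[OF P'] push_corruption_step[OF assms])
  also have "\<dots> \<le> 2 * E * Suc k" using Suc by (simp add: algebra_simps)
  finally show ?case by simp
qed simp

lemma sum_mult_le_l2_norm:
  assumes "\<forall>x\<in>X. 0 < \<pi> x"
  shows "(\<Sum>x\<in>X. m x * f x) \<le> sqrt (\<Sum>x\<in>X. (m x)\<^sup>2 / \<pi> x) * l2_norm X \<pi> f"
proof -
  have "(\<Sum>x\<in>X. m x * f x) = (\<Sum>x\<in>X. (m x / sqrt (\<pi> x)) * (sqrt (\<pi> x) * f x))"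
    using assms by (intro sum.cong) auto
  also have "\<dots> \<le> sqrt ((\<Sum>x\<in>X. (m x / sqrt (\<pi> x))\<^sup>2) * (\<Sum>x\<in>X. (sqrt (\<pi> x) * f x)\<^sup>2))"
    by (intro real_le_rsqrt Cauchy_Schwarz_ineq_sum)
  also have "\<dots> = sqrt (\<Sum>x\<in>X. (m x)\<^sup>2 / \<pi> x) * l2_norm X \<pi> f"
    using assms by (simp add: l2_norm_def power_divide power_mult_distrib less_imp_le real_sqrt_mult)
  finally show ?thesis .
qed

text \<open>
  For a bounded density \<open>\<mu> / \<pi>\<close> the spectral gap gives exponential decay, but \<open>\<mu>\<close> may have a large
  density on a small set. Therefore \<open>\<mu>\<close> is truncated to density at most \<open>1 / \<epsilon>\<close>. The truncated part
  has \<open>L\<^sup>2\<close> norm at most \<open>1 / sqrt \<epsilon>\<close>. The set where \<open>\<mu> / \<pi>\<close> exceeds \<open>1 / \<epsilon>\<close> has \<open>\<pi>\<close>-mass at most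
  \<open>\<epsilon>\<close> by Markov's inequality, hence \<open>\<mu>\<close>-mass at most \<open>E\<close>, and this bounds the mass removed. The
  truncation level does not depend on \<open>p\<close>, which is what makes the final constants uniform in \<open>p\<close>.
\<close>

lemma push_mixing:
  assumes "finite X" "transition_matrix X P" and st: "stationary X P \<pi>" and pos: "\<forall>x\<in>X. 0 < \<pi> x"
    and \<gamma>: "\<gamma> \<le> spectral_gap X P \<pi>" and \<epsilon>: "0 < \<epsilon>"
    and \<mu>: "distribution X \<mu>" and tr: "small_mean_transfers X \<pi> \<epsilon> E \<mu>"
  shows "(\<Sum>y\<in>X. \<bar>(push X P ^^ k) \<mu> y - \<pi> y\<bar>) \<le> (1 - \<gamma>) ^ k / sqrt \<epsilon> + 2 * E"
proof -
  define v where "v = (push X P ^^ k) \<mu>"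
  \<comment> \<open>The sign function attains the \<open>L\<^sup>1\<close> distance; centring it makes the spectral gap applicable.\<close>
  define g where "g y = sgn (v y - \<pi> y)" for y
  define a where "a = (\<Sum>y\<in>X. \<pi> y * g y)"
  define f where "f y = g y - a" for y
  have sum1: "(\<Sum>y\<in>X. \<pi> y) = 1" "(\<Sum>y\<in>X. v y) = 1" "(\<Sum>x\<in>X. \<mu> x) = 1"
    using st \<mu> distribution_push_funpow[OF assms(2) \<mu>]
    by (auto simp: stationary_def distribution_def v_def)
  have g1: "\<bar>g y\<bar> \<le> 1" "(g y)\<^sup>2 \<le> 1" for y by (auto simp: g_def sgn_if)
  have mean: "(\<Sum>y\<in>X. \<pi> y * f y) = 0"
    using sum1 by (simp add: f_def a_def right_diff_distrib sum_subtractf flip: sum_distrib_right)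
  have a1: "\<bar>a\<bar> \<le> 1"
  proof -
    have "\<bar>a\<bar> \<le> (\<Sum>y\<in>X. \<pi> y * 1)"
      unfolding a_def using pos g1
      by (intro order.trans[OF sum_abs] sum_mono) (auto simp: abs_mult intro!: mult_mono)
    then show ?thesis using sum1 by simp
  qed
  have norm_f: "l2_norm X \<pi> f \<le> 1"
  proof -
    have "(\<Sum>y\<in>X. \<pi> y * (f y)\<^sup>2)
        = (\<Sum>y\<in>X. \<pi> y * (g y)\<^sup>2) - 2 * a * (\<Sum>y\<in>X. \<pi> y * g y) + a\<^sup>2 * (\<Sum>y\<in>X. \<pi> y)"
      by (simp add: f_def power2_eq_square algebra_simps sum.distrib sum_subtractf sum_distrib_left)
    also have "\<dots> \<le> (\<Sum>y\<in>X. \<pi> y * (g y)\<^sup>2)"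
      using sum1 by (simp add: a_def power2_eq_square)
    also have "\<dots> \<le> (\<Sum>y\<in>X. \<pi> y * 1)"
      using pos g1 by (intro sum_mono mult_left_mono) (auto simp: less_imp_le)
    finally show ?thesis using sum1 by (simp add: l2_norm_def)
  qed
  have "(\<Sum>y\<in>X. \<bar>v y - \<pi> y\<bar>) = (\<Sum>y\<in>X. (v y - \<pi> y) * g y)"
    by (simp add: g_def abs_sgn)
  also have "\<dots> = (\<Sum>y\<in>X. v y * f y)"
    using sum1 by (simp add: f_def left_diff_distrib right_diff_distrib sum_subtractf a_def
        flip: sum_distrib_right)
  also have "\<dots> = (\<Sum>x\<in>X. \<mu> x * (pull X P ^^ k) f x)"
    unfolding v_def by (rule sum_push_funpow_mult)
  finally have dual: "(\<Sum>y\<in>X. \<bar>v y - \<pi> y\<bar>) = (\<Sum>x\<in>X. \<mu> x * (pull X P ^^ k) f x)" .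

  define F where "F = (pull X P ^^ k) f"
  have F2: "\<bar>F x\<bar> \<le> 2" if x: "x \<in> X" for x
  proof -
    \<comment> \<open>The range lemma for \<open>pull\<close> concerns the unit interval; \<open>(f + 2) / 4\<close> lies there.\<close>
    have scale: "(pull X P ^^ k) (\<lambda>y. (f y + 2) / 4) x = (F x + 2) / 4" if "x \<in> X" for x
      using that unfolding F_def
    proof (induction k arbitrary: x)
      case (Suc k)
      have "pull X P ((pull X P ^^ k) (\<lambda>y. (f y + 2) / 4)) x
          = pull X P (\<lambda>z. ((pull X P ^^ k) f z + 2) / 4) x"
        unfolding pull_def[of X P _ x] using Suc.IH by (intro sum.cong) auto
      also have "\<dots> = (pull X P ((pull X P ^^ k) f) x + 2) / 4"
        using transition_matrix_sum[OF assms(2) Suc.prems]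
        by (simp add: pull_def[of X P _ x] distrib_left sum.distrib flip: sum_divide_distrib sum_distrib_right)
      finally show ?case by simp
    qed simp
    have "0 \<le> (f y + 2) / 4 \<and> (f y + 2) / 4 \<le> 1" for y
      using a1 g1(1)[of y] by (simp add: f_def abs_le_iff)
    then show ?thesis
      using pull_funpow_range[OF assms(2), of "\<lambda>y. (f y + 2) / 4" x k] x scale[OF x] by (auto simp: abs_le_iff)
  qed

  \<comment> \<open>The truncation of \<open>\<mu>\<close>, and the indicator of the set where it differs from \<open>\<mu>\<close>.\<close>
  define m where "m x = min (\<mu> x) (\<pi> x / \<epsilon>)" for x
  define h where "h x = (if \<pi> x < \<epsilon> * \<mu> x then 1 else 0 :: real)" for x
  have \<mu>0: "0 \<le> \<mu> x" if "x \<in> X" for x using that \<mu> by (simp add: distribution_def)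
  have m0: "0 \<le> m x" "m x \<le> \<mu> x" "m x \<le> \<pi> x / \<epsilon>" if "x \<in> X" for x
    using that \<mu>0 pos \<epsilon> by (auto simp: m_def less_imp_le)
  have "(\<Sum>x\<in>X. \<pi> x * h x) \<le> (\<Sum>x\<in>X. \<epsilon> * \<mu> x)"
    using \<mu>0 \<epsilon> by (intro sum_mono) (auto simp: h_def)
  also have "\<dots> = \<epsilon>" using sum1 by (simp flip: sum_distrib_left)
  finally have "(\<Sum>x\<in>X. \<mu> x * h x) \<le> E"
    using tr by (auto simp: small_mean_transfers_def h_def)
  moreover have "\<mu> x - m x \<le> \<mu> x * h x" if "x \<in> X" for x
    using m0[OF that] \<epsilon> by (auto simp: h_def m_def field_simps min_def)
  ultimately have tail: "(\<Sum>x\<in>X. \<mu> x - m x) \<le> E"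
    by (meson order.trans sum_mono)
  have "(\<Sum>x\<in>X. (m x)\<^sup>2 / \<pi> x) \<le> (\<Sum>x\<in>X. \<mu> x / \<epsilon>)"
  proof (intro sum_mono)
    fix x assume x: "x \<in> X"
    have "(m x)\<^sup>2 / \<pi> x \<le> \<mu> x * (\<pi> x / \<epsilon>) / \<pi> x"
      unfolding power2_eq_square using m0[OF x] \<mu>0[OF x] pos x
      by (intro divide_right_mono mult_mono) (auto simp: less_imp_le)
    then show "(m x)\<^sup>2 / \<pi> x \<le> \<mu> x / \<epsilon>" using pos x by auto
  qed
  also have "\<dots> = 1 / \<epsilon>" using sum1 by (simp flip: sum_divide_distrib)
  finally have m2: "(\<Sum>x\<in>X. (m x)\<^sup>2 / \<pi> x) \<le> 1 / \<epsilon>" .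
  have g0: "0 \<le> 1 - \<gamma>"
    using \<gamma> spectral_gap_le_1[OF assms(1-4)] by linarith
  have nF: "l2_norm X \<pi> F \<le> (1 - \<gamma>) ^ k"
    using l2_norm_pull_funpow[OF assms(1-5) mean, of k] mult_left_mono[OF norm_f, of "(1 - \<gamma>) ^ k"] g0
    by (simp add: F_def)
  have "(\<Sum>x\<in>X. \<mu> x * F x) = (\<Sum>x\<in>X. m x * F x) + (\<Sum>x\<in>X. (\<mu> x - m x) * F x)"
    by (simp add: left_diff_distrib flip: sum.distrib)
  also have "(\<Sum>x\<in>X. (\<mu> x - m x) * F x) \<le> (\<Sum>x\<in>X. (\<mu> x - m x) * 2)"
    using F2 m0 by (intro sum_mono mult_left_mono) (auto simp: abs_le_iff)
  also have "\<dots> \<le> 2 * E" using tail unfolding sum_distrib_right[symmetric] by simp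
  also have "(\<Sum>x\<in>X. m x * F x) \<le> sqrt (\<Sum>x\<in>X. (m x)\<^sup>2 / \<pi> x) * l2_norm X \<pi> F"
    by (rule sum_mult_le_l2_norm[OF pos])
  also have "\<dots> \<le> sqrt (1 / \<epsilon>) * (1 - \<gamma>) ^ k"
    using pos \<epsilon> m2 nF by (intro mult_mono) (auto simp: l2_norm_def less_imp_le intro!: sum_nonneg)
  finally show ?thesis using dual by (simp add: F_def v_def real_sqrt_divide)
qed

text \<open>
  Testing \<open>\<nu>\<close> with a centred indicator and pulling the test function back \<open>k\<close> steps shows that
  \<open>\<nu> z - \<pi> z\<close> is bounded by a sequence that decays like \<open>(1 - \<gamma>) ^ k\<close>. So \<open>\<nu> \<le> \<pi>\<close> pointwise, and
  two distributions in this order coincide. The restart parameter is zero when \<open>\<epsilon> = 0\<close>,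
  and uniqueness of the output then rests on this lemma.
\<close>

lemma stationary_unique:
  assumes "finite X" "transition_matrix X P" "stationary X P \<pi>" and pos: "\<forall>x\<in>X. 0 < \<pi> x"
    and "0 < spectral_gap X P \<pi>" and \<nu>: "stationary X P \<nu>" and x: "x \<in> X"
  shows "\<nu> x = \<pi> x"
proof -
  define \<gamma> where "\<gamma> = spectral_gap X P \<pi>"
  have \<gamma>: "0 < \<gamma>" "\<gamma> \<le> 1" using assms(5) spectral_gap_le_1[OF assms(1-4)] by (auto simp: \<gamma>_def)
  have sum1: "(\<Sum>y\<in>X. \<pi> y) = 1" "(\<Sum>y\<in>X. \<nu> y) = 1"
    using assms(3) \<nu> by (auto simp: stationary_def distribution_def)
  have le: "\<nu> z \<le> \<pi> z" if z: "z \<in> X" for z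
  proof -
    define f where "f y = (if y = z then 1 else 0) - \<pi> z" for y
    define K where "K = sqrt (\<Sum>x\<in>X. (\<nu> x)\<^sup>2 / \<pi> x)"
    have mean: "(\<Sum>y\<in>X. \<sigma> y * f y) = \<sigma> z - \<pi> z" if "(\<Sum>y\<in>X. \<sigma> y) = 1" for \<sigma> :: "'a \<Rightarrow> real"
    proof -
      have "(\<Sum>y\<in>X. \<sigma> y * f y) = (\<Sum>y\<in>X. (if y = z then \<sigma> y else 0) - \<sigma> y * \<pi> z)"
        by (intro sum.cong) (auto simp: f_def algebra_simps)
      also have "\<dots> = \<sigma> z - (\<Sum>y\<in>X. \<sigma> y) * \<pi> z"
        using assms(1) z by (simp add: sum_subtractf sum_distrib_right)
      finally show ?thesis using that by simp
    qed
    have "0 \<le> K" using pos by (auto simp: K_def less_imp_le intro!: sum_nonneg)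
    have "\<nu> z - \<pi> z \<le> (1 - \<gamma>) ^ k * (K * l2_norm X \<pi> f)" for k
    proof -
      have "\<nu> z - \<pi> z = (\<Sum>y\<in>X. \<nu> y * (pull X P ^^ k) f y)"
        using mean[OF sum1(2)] by (simp add: stationary_mean_pull_funpow[OF \<nu>])
      also have "\<dots> \<le> K * l2_norm X \<pi> ((pull X P ^^ k) f)"
        unfolding K_def by (rule sum_mult_le_l2_norm[OF pos])
      also have "\<dots> \<le> K * ((1 - \<gamma>) ^ k * l2_norm X \<pi> f)"
        using mean[OF sum1(1)] assms(1-4) \<open>0 \<le> K\<close>
        by (intro mult_left_mono l2_norm_pull_funpow) (auto simp: \<gamma>_def)
      finally show ?thesis by (simp add: mult_ac)
    qed
    moreover have "(\<lambda>k. (1 - \<gamma>) ^ k * (K * l2_norm X \<pi> f)) \<longlonglongrightarrow> 0 * (K * l2_norm X \<pi> f)"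
      using \<gamma> by (intro tendsto_intros LIMSEQ_power_zero) auto
    ultimately have "\<nu> z - \<pi> z \<le> 0"
      by (intro LIMSEQ_le_const[of _ 0 "\<nu> z - \<pi> z"]) auto
    then show ?thesis by simp
  qed
  have "(\<Sum>y\<in>X. \<pi> y - \<nu> y) = 0" using sum1 by (simp add: sum_subtractf)
  then show ?thesis using le assms(1) x by (simp add: sum_nonneg_eq_0_iff)
qed

section \<open>The PageRank distribution as a geometric mixture\<close>

text \<open>
  The law of the walk \<open>Q\<close> started from \<open>\<mu>\<close> and stopped at an independent geometric time. Outside \<open>X\<close>
  the series need not converge.
\<close>

definition pagerank :: "'a set \<Rightarrow> ('a \<Rightarrow> 'a \<Rightarrow> real) \<Rightarrow> ('a \<Rightarrow> real) \<Rightarrow> real \<Rightarrow> 'a \<Rightarrow> real" where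
  "pagerank X Q \<mu> \<delta> y = (\<Sum>k. \<delta> * (1 - \<delta>) ^ k * (push X Q ^^ k) \<mu> y)"

lemma geometric_weights_sums:
  fixes \<delta> :: real
  assumes "0 < \<delta>" "\<delta> \<le> 1"
  shows "(\<lambda>k. \<delta> * (1 - \<delta>) ^ k) sums 1"
  using sums_mult[OF geometric_sums[of "1 - \<delta>"], of \<delta>] assms by simp

lemma pagerank_sums:
  assumes "finite X" "transition_matrix X Q" "distribution X \<mu>" "0 < \<delta>" "\<delta> \<le> 1" "y \<in> X"
  shows "(\<lambda>k. \<delta> * (1 - \<delta>) ^ k * (push X Q ^^ k) \<mu> y) sums pagerank X Q \<mu> \<delta> y"
  unfolding pagerank_def
proof (rule summable_sums, rule summable_comparison_test')
  show "summable (\<lambda>k. \<delta> * (1 - \<delta>) ^ k)"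
    using geometric_weights_sums[OF assms(4,5)] by (rule sums_summable)
  fix k
  have "distribution X ((push X Q ^^ k) \<mu>)"
    using assms by (intro distribution_push_funpow)
  then have "0 \<le> (push X Q ^^ k) \<mu> y" "(push X Q ^^ k) \<mu> y \<le> 1"
    using member_le_sum[of y X "(push X Q ^^ k) \<mu>"] assms(1,6) by (auto simp: distribution_def)
  then show "norm (\<delta> * (1 - \<delta>) ^ k * (push X Q ^^ k) \<mu> y) \<le> \<delta> * (1 - \<delta>) ^ k"
    using assms(4,5) by (simp add: abs_mult mult_left_le)
qed

lemma push_pagerank_chain:
  assumes "distribution X \<nu>"
  shows "push X (pagerank_chain Q \<mu> \<delta>) \<nu> y = (1 - \<delta>) * push X Q \<nu> y + \<delta> * \<mu> y"
proof -
  have "push X (pagerank_chain Q \<mu> \<delta>) \<nu> y = (1 - \<delta>) * push X Q \<nu> y + (\<Sum>x\<in>X. \<nu> x) * (\<delta> * \<mu> y)"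
    unfolding push_def pagerank_chain_def sum_distrib_left sum_distrib_right sum.distrib[symmetric]
    by (intro sum.cong) (auto simp: algebra_simps)
  then show ?thesis using assms by (simp add: distribution_def)
qed

text \<open>
  Shifting the geometric series by one step shows that it solves the fixed point equation. The
  difference \<open>s\<close> of two solutions satisfies \<open>s = (1 - \<delta>) * push X Q s\<close>, and \<open>push\<close> does not increase
  the \<open>L\<^sup>1\<close> norm, so \<open>s\<close> vanishes.
\<close>

lemma pagerank_output_pagerank:
  assumes "finite X" "transition_matrix X Q" "distribution X \<mu>" "0 < \<delta>" "\<delta> \<le> 1"
  shows "pagerank_output X Q \<mu> \<delta> (pagerank X Q \<mu> \<delta>)"
proof -
  let ?\<nu> = "pagerank X Q \<mu> \<delta>"
  define w where "w k = \<delta> * (1 - \<delta>) ^ k" for k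
  define v where "v k = (push X Q ^^ k) \<mu>" for k
  have v: "distribution X (v k)" for k unfolding v_def using assms by (intro distribution_push_funpow)
  have \<nu>: "(\<lambda>k. w k * v k y) sums ?\<nu> y" if "y \<in> X" for y
    using pagerank_sums[OF assms that] by (simp add: w_def v_def)
  have w: "w sums 1" using geometric_weights_sums[OF assms(4,5)] by (simp add: w_def[abs_def])
  have w0: "0 \<le> w k" for k using assms(4,5) by (simp add: w_def)
  have "(\<lambda>k. \<Sum>y\<in>X. w k * v k y) sums (\<Sum>y\<in>X. ?\<nu> y)"
    using \<nu> by (intro sums_sum)
  then have "w sums (\<Sum>y\<in>X. ?\<nu> y)"
    using v by (simp add: distribution_def flip: sum_distrib_left)
  then have "(\<Sum>y\<in>X. ?\<nu> y) = 1" using w sums_unique2 by blast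
  moreover have "0 \<le> ?\<nu> y" if "y \<in> X" for y
    using v w0 that by (intro sums_le[OF _ sums_zero \<nu>[OF that]]) (auto simp: distribution_def)
  ultimately have dist: "distribution X ?\<nu>" by (simp add: distribution_def)
  have fixed: "push X (pagerank_chain Q \<mu> \<delta>) ?\<nu> y = ?\<nu> y" if y: "y \<in> X" for y
  proof -
    have "(\<lambda>k. \<Sum>x\<in>X. w k * v k x * Q x y) sums push X Q ?\<nu> y"
      unfolding push_def using \<nu> by (intro sums_sum sums_mult2)
    moreover have "(\<Sum>x\<in>X. w k * v k x * Q x y) = w k * v (Suc k) y" for k
      by (simp add: v_def push_def sum_distrib_left mult.assoc)
    ultimately have "(\<lambda>k. (1 - \<delta>) * (w k * v (Suc k) y)) sums ((1 - \<delta>) * push X Q ?\<nu> y)"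
      by (intro sums_mult) simp
    moreover have "(1 - \<delta>) * (w k * v (Suc k) y) = w (Suc k) * v (Suc k) y" for k
      by (simp add: w_def)
    ultimately have "(\<lambda>k. w (Suc k) * v (Suc k) y) sums ((1 - \<delta>) * push X Q ?\<nu> y)"
      by (simp only:)
    then have "(\<lambda>k. w k * v k y) sums ((1 - \<delta>) * push X Q ?\<nu> y + w 0 * v 0 y)"
      by (rule sums_Suc)
    then have "?\<nu> y = (1 - \<delta>) * push X Q ?\<nu> y + w 0 * v 0 y"
      using \<nu>[OF y] sums_unique2 by blast
    then show ?thesis
      by (simp add: push_pagerank_chain[OF dist] w_def v_def)
  qed
  have stat: "stationary X (pagerank_chain Q \<mu> \<delta>) ?\<nu>"
    using dist fixed by (simp add: stationary_def push_def)
  have unique: "\<nu>' y = ?\<nu> y" if \<nu>': "stationary X (pagerank_chain Q \<mu> \<delta>) \<nu>'" and y: "y \<in> X" for \<nu>' y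
  proof -
    define s where "s x = \<nu>' x - ?\<nu> x" for x
    have "\<bar>s x\<bar> = (1 - \<delta>) * \<bar>push X Q s x\<bar>" if "x \<in> X" for x
    proof -
      have "s x = push X (pagerank_chain Q \<mu> \<delta>) \<nu>' x - push X (pagerank_chain Q \<mu> \<delta>) ?\<nu> x"
        unfolding s_def using stationaryD(2)[OF \<nu>' that] fixed[OF that] by simp
      also have "\<dots> = (1 - \<delta>) * push X Q s x"
        unfolding s_def using push_pagerank_chain[OF stationaryD(1)[OF \<nu>']] push_pagerank_chain[OF dist]
        by (simp add: push_diff algebra_simps)
      finally show ?thesis using assms(5) by (simp add: abs_mult)
    qed
    then have "(\<Sum>x\<in>X. \<bar>s x\<bar>) = (1 - \<delta>) * (\<Sum>x\<in>X. \<bar>push X Q s x\<bar>)"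
      by (simp add: sum_distrib_left)
    also have "\<dots> \<le> (1 - \<delta>) * (\<Sum>x\<in>X. \<bar>s x\<bar>)"
      using assms by (intro mult_left_mono sum_abs_push_le) auto
    finally have "\<delta> * (\<Sum>x\<in>X. \<bar>s x\<bar>) \<le> 0" by (simp add: algebra_simps)
    then have "(\<Sum>x\<in>X. \<bar>s x\<bar>) = 0"
      using assms(4) by (intro antisym) (auto simp: mult_le_0_iff sum_nonneg)
    then show ?thesis using assms(1) y by (simp add: sum_nonneg_eq_0_iff s_def)
  qed
  show ?thesis using stat unique by (simp add: pagerank_output_def)
qed

text \<open>
  The hypothesis bounds the distance at time \<open>k\<close> by a linear drift, a constant, and the trivial bound
  2 before a burn-in time \<open>T\<close>. Averaging over the geometric time turns the drift into \<open>a / \<delta>\<close>, and the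
  walk is stopped before \<open>T\<close> with probability at most \<open>\<delta> * T\<close>. The drift is taken proportional to \<open>Suc k\<close>
  because the geometric weights give \<open>Suc k\<close> the exact mean \<open>1 / \<delta>\<close>.
\<close>

lemma pagerank_distance_le:
  fixes a c :: real and T :: nat
  assumes "finite X" "transition_matrix X Q" "distribution X \<mu>" and \<delta>: "0 < \<delta>" "\<delta> \<le> 1"
    and bound: "\<And>k. (\<Sum>y\<in>X. \<bar>(push X Q ^^ k) \<mu> y - \<pi> y\<bar>) \<le> a * Suc k + c + (if k < T then 2 else 0)"
  shows "(\<Sum>y\<in>X. \<bar>pagerank X Q \<mu> \<delta> y - \<pi> y\<bar>) \<le> a / \<delta> + c + 2 * \<delta> * T"
proof -
  let ?\<nu> = "pagerank X Q \<mu> \<delta>"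
  define w where "w k = \<delta> * (1 - \<delta>) ^ k" for k
  define v where "v k = (push X Q ^^ k) \<mu>" for k
  \<comment> \<open>Pairing with signs gives the \<open>L\<^sup>1\<close> distance by a finite linear combination of convergent series.\<close>
  define g where "g y = sgn (?\<nu> y - \<pi> y)" for y
  have w: "w sums 1" using geometric_weights_sums[OF \<delta>] by (simp add: w_def[abs_def])
  have w0: "0 \<le> w k" "w k \<le> \<delta>" for k
    using \<delta> by (auto simp: w_def intro!: mult_left_le power_le_one)
  have "(\<lambda>k. (w k * v k y - w k * \<pi> y) * g y) sums ((?\<nu> y - 1 * \<pi> y) * g y)" if "y \<in> X" for y
    using pagerank_sums[OF assms(1-5) that] w
    by (intro sums_mult2 sums_diff) (simp_all add: w_def[abs_def] v_def)
  then have "(\<lambda>k. \<Sum>y\<in>X. (w k * v k y - w k * \<pi> y) * g y) sums (\<Sum>y\<in>X. (?\<nu> y - 1 * \<pi> y) * g y)"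
    by (rule sums_sum)
  moreover have "(\<Sum>y\<in>X. (w k * v k y - w k * \<pi> y) * g y) = w k * (\<Sum>y\<in>X. (v k y - \<pi> y) * g y)" for k
    by (simp add: sum_distrib_left algebra_simps)
  moreover have "(\<Sum>y\<in>X. (?\<nu> y - 1 * \<pi> y) * g y) = (\<Sum>y\<in>X. \<bar>?\<nu> y - \<pi> y\<bar>)"
    by (simp add: g_def abs_sgn)
  ultimately have 1: "(\<lambda>k. w k * (\<Sum>y\<in>X. (v k y - \<pi> y) * g y)) sums (\<Sum>y\<in>X. \<bar>?\<nu> y - \<pi> y\<bar>)"
    by simp
  \<comment> \<open>The derivative of the geometric series gives the mean of \<open>Suc k\<close> under the weights.\<close>
  have "(\<lambda>k. \<delta> * (real (Suc k) * (1 - \<delta>) ^ k)) sums (\<delta> * (1 / (1 - (1 - \<delta>))\<^sup>2))"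
    using \<delta> geometric_deriv_sums[of "1 - \<delta>"] by (intro sums_mult) simp
  then have "(\<lambda>k. w k * Suc k) sums (1 / \<delta>)"
    using \<delta> by (simp add: w_def mult_ac power2_eq_square)
  then have "(\<lambda>k. a * (w k * Suc k)) sums (a * (1 / \<delta>))"
    by (rule sums_mult)
  moreover have "(\<lambda>k. if k \<in> {..<T} then 2 * w k else 0) sums (\<Sum>k<T. 2 * w k)"
    by (rule sums_If_finite_set) simp
  ultimately have "(\<lambda>k. a * (w k * Suc k) + c * w k + (if k \<in> {..<T} then 2 * w k else 0))
      sums (a * (1 / \<delta>) + c * 1 + (\<Sum>k<T. 2 * w k))"
    using sums_mult[OF w, of c] by (intro sums_add) auto
  moreover have "w k * (\<Sum>y\<in>X. (v k y - \<pi> y) * g y)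
      \<le> a * (w k * Suc k) + c * w k + (if k \<in> {..<T} then 2 * w k else 0)" for k
  proof -
    have "(\<Sum>y\<in>X. (v k y - \<pi> y) * g y) \<le> (\<Sum>y\<in>X. \<bar>v k y - \<pi> y\<bar>)"
      by (intro sum_mono) (auto simp: g_def sgn_if)
    also have "\<dots> \<le> a * Suc k + c + (if k < T then 2 else 0)" unfolding v_def by (rule bound)
    finally have "w k * (\<Sum>y\<in>X. (v k y - \<pi> y) * g y) \<le> w k * (a * Suc k + c + (if k < T then 2 else 0))"
      by (rule mult_left_mono) (rule w0)
    then show ?thesis by (simp add: algebra_simps split: if_splits)
  qed
  ultimately have "(\<Sum>y\<in>X. \<bar>?\<nu> y - \<pi> y\<bar>) \<le> a * (1 / \<delta>) + c * 1 + (\<Sum>k<T. 2 * w k)"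
    by (rule sums_le[OF _ 1, rotated])
  moreover have "(\<Sum>k<T. 2 * w k) \<le> (\<Sum>k<T. 2 * \<delta>)" using w0 by (intro sum_mono) auto
  ultimately show ?thesis by (simp add: mult_ac)
qed

section \<open>The error bound and the choice of the restart parameter\<close>

text \<open>
  With \<open>E = \<beta> * \<epsilon> powr (1 / q)\<close> the drift costs \<open>E / \<delta>\<close> and the burn-in costs about \<open>\<delta> / \<gamma>\<close>; the choice
  \<open>\<delta> = sqrt (\<gamma> * E)\<close> balances them. The exponent \<open>1 / q\<close> is expressed through \<open>p\<close>. The cap at 1
  matters only when \<open>E\<close> exceeds \<open>\<gamma>\<close>, where the claimed bound is trivial.
\<close>

definition restart_parameter :: "ereal \<Rightarrow> real \<Rightarrow> real \<Rightarrow> real \<Rightarrow> real" where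
  "restart_parameter p \<beta> \<gamma> \<epsilon> = min 1 (sqrt (\<gamma> * (\<beta> * \<epsilon> powr (1 - real_of_ereal (1 / p)))))"

lemma tv_dist_le_1:
  assumes "distribution X \<nu>" "distribution X \<pi>"
  shows "tv_dist X \<nu> \<pi> \<le> 1"
proof -
  have "(\<Sum>x\<in>X. \<bar>\<nu> x - \<pi> x\<bar>) \<le> (\<Sum>x\<in>X. \<nu> x + \<pi> x)"
    using assms by (intro sum_mono) (auto simp: distribution_def abs_le_iff add_increasing)
  then show ?thesis using assms by (simp add: tv_dist_def sum.distrib distribution_def)
qed

text \<open>
  Before time \<open>T\<close> the original walk is only known to be a distribution, hence within \<open>L\<^sup>1\<close> distance 2 of
  \<open>\<pi>\<close>; from time \<open>T\<close> on the mixing estimate applies. The drift of the corrupted walk is added to both.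
\<close>

lemma pagerank_corruption_bound:
  fixes T :: nat
  assumes "finite X" "transition_matrix X P" "stationary X P \<pi>" "\<forall>x\<in>X. 0 < \<pi> x"
    and "\<gamma> \<le> spectral_gap X P \<pi>" "0 < \<epsilon>" and \<gamma>0: "0 < \<gamma>"
    and corr: "eps_corruption X P \<pi> \<epsilon> P'"
    and \<mu>: "distribution X \<mu>" and tr: "small_mean_transfers X \<pi> \<epsilon> E \<mu>" and \<delta>: "0 < \<delta>" "\<delta> \<le> 1"
  shows "tv_dist X (pagerank X P' \<mu> \<delta>) \<pi>
      \<le> E / \<delta> + E + \<delta> * T + (1 - \<gamma>) ^ T / (2 * sqrt \<epsilon>)"
proof -
  have P': "transition_matrix X P'" using corr by (simp add: eps_corruption_def)
  have dist: "distribution X \<pi>" using assms(3) by (simp add: stationary_def)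
  have \<gamma>: "0 \<le> 1 - \<gamma>" using assms(5) spectral_gap_le_1[OF assms(1-4)] by simp
  have E: "0 \<le> E"
    using tr[unfolded small_mean_transfers_def, rule_format, of "\<lambda>_. 0"] assms(6) by simp
  have "(\<Sum>y\<in>X. \<bar>(push X P' ^^ k) \<mu> y - \<pi> y\<bar>)
      \<le> 2 * E * Suc k + (2 * E + (1 - \<gamma>) ^ T / sqrt \<epsilon>) + (if k < T then 2 else 0)" for k
  proof -
    have "(\<Sum>y\<in>X. \<bar>(push X P ^^ k) \<mu> y - \<pi> y\<bar>)
        \<le> 2 * E + (1 - \<gamma>) ^ T / sqrt \<epsilon> + (if k < T then 2 else 0)"
    proof (cases "k < T")
      case True
      then show ?thesis
        using tv_dist_le_1[OF distribution_push_funpow[OF assms(2) \<mu>, of k] dist] E \<gamma> assms(6)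
        by (simp add: tv_dist_def add_increasing)
    next
      case False
      then have "(1 - \<gamma>) ^ k / sqrt \<epsilon> \<le> (1 - \<gamma>) ^ T / sqrt \<epsilon>"
        using \<gamma> assms(5,6) \<gamma>0 by (intro divide_right_mono power_decreasing) auto
      then show ?thesis
        using push_mixing[OF assms(1-6) \<mu> tr, of k] False by simp
    qed
    moreover have "(\<Sum>y\<in>X. \<bar>(push X P' ^^ k) \<mu> y - (push X P ^^ k) \<mu> y\<bar>) \<le> 2 * E * k"
      by (rule push_corruption_drift[OF assms(2,3) corr \<mu> tr])
    moreover have "(\<Sum>y\<in>X. \<bar>(push X P' ^^ k) \<mu> y - \<pi> y\<bar>)
        \<le> (\<Sum>y\<in>X. \<bar>(push X P' ^^ k) \<mu> y - (push X P ^^ k) \<mu> y\<bar>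
                 + \<bar>(push X P ^^ k) \<mu> y - \<pi> y\<bar>)"
      by (intro sum_mono) simp
    ultimately show ?thesis using E by (simp add: sum.distrib algebra_simps)
  qed
  from pagerank_distance_le[OF assms(1) P' \<mu> \<delta> this]
  show ?thesis by (simp add: tv_dist_def field_simps)
qed

text \<open>
  All terms are compared with \<open>s = sqrt (E / \<gamma>)\<close>, which is less than 1. Since \<open>1 \<le> \<beta>\<close> and \<open>1 \<le> q\<close>,
  \<open>E < \<gamma>\<close> forces \<open>\<epsilon> < 1\<close> and \<open>\<epsilon> \<le> E\<close>. After \<open>T\<close> steps the factor \<open>(1 - \<gamma>) ^ T\<close> has dropped below \<open>\<epsilon>\<close>,
  so the last summand is at most \<open>sqrt \<epsilon> / 2\<close>, and \<open>\<delta> * T\<close> is at most \<open>s * (ln (1 / \<epsilon>) + 1)\<close>.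
\<close>

lemma balanced_error_le:
  fixes \<beta> \<gamma> \<epsilon> q :: real
  assumes "0 < \<gamma>" "\<gamma> \<le> 1" "1 \<le> \<beta>" "0 < \<epsilon>" "1 \<le> q"
    and E: "E = \<beta> * \<epsilon> powr (1 / q)" "E < \<gamma>"
    and \<delta>: "\<delta> = sqrt (\<gamma> * E)" and T: "T = nat \<lceil>ln (1 / \<epsilon>) / \<gamma>\<rceil>"
  shows "E / \<delta> + E + \<delta> * T + (1 - \<gamma>) ^ T / (2 * sqrt \<epsilon>)
    \<le> 5 * ln (2 + \<beta> / (\<gamma> * \<epsilon>)) * sqrt (E / \<gamma>)"
proof -
  define s where "s = sqrt (E / \<gamma>)"
  define l where "l = ln (1 / \<epsilon>)"
  have E0: "0 < E" using assms by simp
  have s0: "0 < s" using E0 assms(1) by (simp add: s_def)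
  have s2: "s\<^sup>2 = E / \<gamma>" using E0 assms(1) by (simp add: s_def)
  have s1: "s < 1" using E assms(1) by (simp add: s_def)
  have \<delta>s: "\<delta> = \<gamma> * s"
    using E0 assms(1) by (simp add: \<delta> s_def real_sqrt_mult real_sqrt_divide field_simps)
  have "\<epsilon> powr (1 / q) < 1"
  proof -
    have "\<epsilon> powr (1 / q) * 1 \<le> \<epsilon> powr (1 / q) * \<beta>" using assms(3) by (intro mult_left_mono) auto
    then show ?thesis using E assms(2) by (simp add: mult.commute)
  qed
  then have \<epsilon>1: "\<epsilon> < 1"
    using assms(4,5) by (meson ge_one_powr_ge_zero not_le zero_le_divide_1_iff order.trans zero_le_one)
  have "\<epsilon> powr 1 \<le> \<epsilon> powr (1 / q)"
    using assms(4,5) \<epsilon>1 by (intro powr_mono') auto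
  then have \<epsilon>p: "\<epsilon> \<le> \<epsilon> powr (1 / q)" using assms(4) by simp
  have "\<epsilon> powr (1 / q) \<le> E" using assms(3) mult_right_mono[of 1 \<beta> "\<epsilon> powr (1 / q)"] by (simp add: E)
  also have Eg: "E \<le> E / \<gamma>" using E0 assms(1,2) by (simp add: field_simps mult_left_le)
  finally have eps_s: "sqrt \<epsilon> \<le> s" using \<epsilon>p unfolding s_def by simp
  have Es: "E \<le> s"
  proof -
    have "E \<le> s * s" using Eg s2 by (simp add: power2_eq_square)
    also have "\<dots> \<le> s * 1" using s0 s1 by (intro mult_left_mono) auto
    finally show ?thesis by simp
  qed
  have l0: "0 \<le> l" using \<epsilon>1 assms(4) by (simp add: l_def)
  have T1: "l / \<gamma> \<le> T" "T \<le> l / \<gamma> + 1" using l0 assms(1) unfolding T l_def[symmetric]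
    by (simp_all add: real_nat_ceiling_ge)
  \<comment> \<open>The burn-in must bring \<open>(1 - \<gamma>) ^ T\<close> down to \<open>\<epsilon>\<close> to absorb the factor \<open>1 / sqrt \<epsilon>\<close> from the truncation.\<close>
  have "(1 - \<gamma>) ^ T \<le> exp (- \<gamma>) ^ T"
    using assms(1,2) exp_ge_add_one_self[of "-\<gamma>"] by (intro power_mono) auto
  also have "\<dots> = exp (- (\<gamma> * T))" by (simp add: mult.commute flip: exp_of_nat_mult)
  also have "\<dots> \<le> exp (- l)" using T1 assms(1) by (simp add: field_simps)
  also have "\<dots> = \<epsilon>" using assms(4) by (simp add: l_def ln_div)
  finally have "(1 - \<gamma>) ^ T / (2 * sqrt \<epsilon>) \<le> \<epsilon> / (2 * sqrt \<epsilon>)"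
    using assms(4) by (intro divide_right_mono) auto
  also have "\<dots> = sqrt \<epsilon> / 2" using assms(4) by (simp add: real_div_sqrt)
  also have "\<dots> \<le> s" using eps_s s0 by simp
  finally have t4: "(1 - \<gamma>) ^ T / (2 * sqrt \<epsilon>) \<le> s" .
  have "\<delta> * T \<le> \<gamma> * s * (l / \<gamma> + 1)"
    unfolding \<delta>s using T1 s0 assms(1) by (intro mult_left_mono) auto
  also have "\<dots> = s * l + \<gamma> * s" using assms(1) by (simp add: field_simps)
  also have "\<dots> \<le> s * l + 1 * s" using assms(2) s0 by (intro add_left_mono mult_right_mono) auto
  finally have t3: "\<delta> * T \<le> s * l + s" by simp
  have t1: "E / \<delta> = s"
    using s2 s0 assms(1) by (simp add: \<delta>s field_simps power2_eq_square)
  define L where "L = ln (2 + \<beta> / (\<gamma> * \<epsilon>))"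
  have ratio: "1 / \<epsilon> \<le> \<beta> / (\<gamma> * \<epsilon>)"
    using assms(1-4) by (simp add: field_simps)
  have "1 \<le> 1 / \<epsilon>" using \<epsilon>1 assms(4) by simp
  then have lL: "l \<le> L" unfolding l_def L_def using ratio assms(4) by (intro ln_mono) auto
  from \<open>1 \<le> 1 / \<epsilon>\<close>
  have "exp 1 \<le> 2 + \<beta> / (\<gamma> * \<epsilon>)" using ratio exp_le by linarith
  then have L1: "1 \<le> L" unfolding L_def by (subst ln_ge_iff) (auto intro: less_le_trans[OF exp_gt_zero])
  have "E / \<delta> + E + \<delta> * T + (1 - \<gamma>) ^ T / (2 * sqrt \<epsilon>) \<le> s * (4 + l)"
    using t1 Es t3 t4 by (simp add: algebra_simps)
  also have "\<dots> \<le> s * (5 * L)" using s0 lL L1 by (intro mult_left_mono) auto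
  finally show ?thesis by (simp add: L_def s_def mult_ac)
qed

theorem theorem1p4:
  shows "\<exists>(C::real) (k::nat) (\<delta> :: ereal \<Rightarrow> real \<Rightarrow> real \<Rightarrow> real \<Rightarrow> real).
    \<forall>(X :: 'a set) P \<pi> P' \<mu> (\<epsilon>::real) (\<gamma>::real) (\<beta>::real) (p::ereal) (q::real).
      finite X \<longrightarrow>
      transition_matrix X P \<longrightarrow>
      stationary X P \<pi> \<longrightarrow>
      (\<forall>x\<in>X. 0 < \<pi> x) \<longrightarrow>
      0 < \<gamma> \<longrightarrow> \<gamma> \<le> spectral_gap X P \<pi> \<longrightarrow>
      eps_corruption X P \<pi> \<epsilon> P' \<longrightarrow>
      1 < p \<longrightarrow> 1 / p + 1 / ereal q = 1 \<longrightarrow>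
      distribution X \<mu> \<longrightarrow>
      smooth X \<pi> \<beta> p \<mu> \<longrightarrow>
      0 \<le> \<delta> p \<beta> \<gamma> \<epsilon> \<and> \<delta> p \<beta> \<gamma> \<epsilon> \<le> 1 \<and>
      (\<exists>\<pi>'. pagerank_output X P' \<mu> (\<delta> p \<beta> \<gamma> \<epsilon>) \<pi>' \<and>
        tv_dist X \<pi>' \<pi> \<le>
          C * ln (2 + \<beta> / (\<gamma> * \<epsilon>)) ^ k * sqrt (\<beta> * \<epsilon> powr (1 / q) / \<gamma>))"
proof (rule exI[of _ 5], rule exI[of _ 1], rule exI[of _ restart_parameter], intro allI impI)
  fix X :: "'a set" and P \<pi> P' \<mu> and \<epsilon> \<gamma> \<beta> :: real and p :: ereal and q :: real
  assume X: "finite X" and P: "transition_matrix X P" and st: "stationary X P \<pi>"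
    and pos: "\<forall>x\<in>X. 0 < \<pi> x" and \<gamma>0: "0 < \<gamma>" and gap: "\<gamma> \<le> spectral_gap X P \<pi>"
    and corr: "eps_corruption X P \<pi> \<epsilon> P'" and pq: "1 < p" "1 / p + 1 / ereal q = 1"
    and \<mu>: "distribution X \<mu>" and smooth: "smooth X \<pi> \<beta> p \<mu>"
  define E where "E = \<beta> * \<epsilon> powr (1 / q)"
  define \<delta> where "\<delta> = restart_parameter p \<beta> \<gamma> \<epsilon>"
  have \<delta>: "\<delta> = min 1 (sqrt (\<gamma> * E))"
    by (simp add: \<delta>_def restart_parameter_def E_def dual_exponent(2)[OF pq])
  have P': "transition_matrix X P'" using corr by (simp add: eps_corruption_def)
  have dist: "distribution X \<pi>" using st by (simp add: stationary_def)
  note transfer = smooth_expectation_le[OF X pos pq \<mu> smooth]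
  have tr: "small_mean_transfers X \<pi> \<epsilon> E \<mu>"
    unfolding small_mean_transfers_def E_def by (intro allI impI transfer) auto
  \<comment> \<open>The constant function 1 has mean 1 under both distributions.\<close>
  have \<beta>: "1 \<le> \<beta>"
    using transfer[of "\<lambda>_. 1" 1] \<mu> dist by (simp add: distribution_def)
  have \<gamma>1: "\<gamma> \<le> 1" using gap spectral_gap_le_1[OF X P st pos] by simp
  have \<epsilon>0: "0 \<le> \<epsilon>"
  proof -
    have "0 \<le> (\<Sum>x\<in>X. \<Sum>y\<in>X. \<pi> x * \<bar>P x y - P' x y\<bar>)"
      using pos by (auto simp: less_imp_le intro!: sum_nonneg)
    then show ?thesis using corr by (simp add: eps_corruption_def)
  qed
  have E0: "0 \<le> E" using \<beta> by (simp add: E_def)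
  have "\<exists>\<pi>'. pagerank_output X P' \<mu> \<delta> \<pi>' \<and>
      tv_dist X \<pi>' \<pi> \<le> 5 * ln (2 + \<beta> / (\<gamma> * \<epsilon>)) * sqrt (E / \<gamma>)"
  proof (cases "\<epsilon> = 0")
    case True
    \<comment> \<open>Without corruption \<open>P'\<close> agrees with \<open>P\<close> on \<open>X\<close>, and without restarts the output is \<open>\<pi>\<close> itself.\<close>
    have "(\<Sum>x\<in>X. \<Sum>y\<in>X. \<pi> x * \<bar>P x y - P' x y\<bar>) = 0"
      using corr pos True
      by (intro antisym) (auto simp: eps_corruption_def less_imp_le intro!: sum_nonneg)
    then have eq: "P x y = P' x y" if "x \<in> X" "y \<in> X" for x y
      using that pos X by (auto simp: sum_nonneg_eq_0_iff sum_nonneg less_imp_le) (metis less_irrefl)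
    have [simp]: "\<delta> = 0" using True by (simp add: \<delta> E_def)
    have "stationary X (pagerank_chain P' \<mu> \<delta>) \<nu> = stationary X P \<nu>" for \<nu>
      by (simp add: stationary_def pagerank_chain_def eq)
    then have "pagerank_output X P' \<mu> \<delta> \<pi>"
      using st stationary_unique[OF X P st pos] \<gamma>0 gap by (auto simp: pagerank_output_def)
    moreover have "tv_dist X \<pi> \<pi> \<le> 5 * ln (2 + \<beta> / (\<gamma> * \<epsilon>)) * sqrt (E / \<gamma>)"
      using True by (simp add: tv_dist_def E_def)
    ultimately show ?thesis by blast
  next
    case False
    then have \<epsilon>: "0 < \<epsilon>" using \<epsilon>0 by simp
    then have Epos: "0 < E" using \<beta> by (simp add: E_def)
    then have \<delta>01: "0 < \<delta>" "\<delta> \<le> 1" using \<gamma>0 by (auto simp: \<delta>)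
    let ?\<nu> = "pagerank X P' \<mu> \<delta>"
    have out: "pagerank_output X P' \<mu> \<delta> ?\<nu>"
      by (rule pagerank_output_pagerank[OF X P' \<mu> \<delta>01])
    have "tv_dist X ?\<nu> \<pi> \<le> 5 * ln (2 + \<beta> / (\<gamma> * \<epsilon>)) * sqrt (E / \<gamma>)"
    proof (cases "E < \<gamma>")
      case True
      have "\<gamma> * E \<le> 1 * 1" using True \<gamma>0 \<gamma>1 E0 by (intro mult_mono) auto
      then have "\<delta> = sqrt (\<gamma> * E)" by (simp add: \<delta>)
      from balanced_error_le[OF \<gamma>0 \<gamma>1 \<beta> \<epsilon> dual_exponent(1)[OF pq] E_def True this refl]
      show ?thesis
        using pagerank_corruption_bound[OF X P st pos gap \<epsilon> \<gamma>0 corr \<mu> tr \<delta>01] by (rule order.trans[rotated])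
    next
      case False
      \<comment> \<open>Here \<open>sqrt (E / \<gamma>)\<close> is at least 1, and so is \<open>5 * ln 2\<close>.\<close>
      have "tv_dist X ?\<nu> \<pi> \<le> 1"
        using out dist by (intro tv_dist_le_1) (auto simp: pagerank_output_def stationary_def)
      also have "1 \<le> 5 * ln 2 * (1 :: real)" using ln2_ge_two_thirds by simp
      also have "\<dots> \<le> 5 * ln (2 + \<beta> / (\<gamma> * \<epsilon>)) * sqrt (E / \<gamma>)"
        using False \<beta> \<gamma>0 \<epsilon> by (intro mult_mono ln_mono) auto
      finally show ?thesis .
    qed
    then show ?thesis using out by blast
  qed
  then show "0 \<le> restart_parameter p \<beta> \<gamma> \<epsilon> \<and> restart_parameter p \<beta> \<gamma> \<epsilon> \<le> 1 \<and>
      (\<exists>\<pi>'. pagerank_output X P' \<mu> (restart_parameter p \<beta> \<gamma> \<epsilon>) \<pi>' \<and>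
        tv_dist X \<pi>' \<pi> \<le>
          5 * ln (2 + \<beta> / (\<gamma> * \<epsilon>)) ^ 1 * sqrt (\<beta> * \<epsilon> powr (1 / q) / \<gamma>))"
    using E0 \<gamma>0 \<delta> by (simp add: \<delta>_def E_def)
qed

end
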